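(* Let $(\kappa, k_1, k_2) \in \mathcal{L}_1^1$, i.e. let $\kappa, k_1, k_2 \in C_{-1}(0,+\infty)$ satisfy $(\kappa * k_1 * k_2)(t) = 1$ for all $t>0$. Then for every $f \in C_{-1,(k_2)}^{1}(0,+\infty)$, $$(\mathbb{I}_{(\kappa)}\; {}_{1L}\mathbb{D}_{(k_1,k_2)}\, f)(t) = f(t) - (\mathbb{I}_{(k_2)}\, f)(0)\,(k_1 * \kappa)(t), \qquad t>0.$$
   Context: Functions are real-valued and defined on $(0,+\infty)$. The space $C_{-1}(0,+\infty)$ is $$C_{-1}(0,+\infty) := \{f:\ f(t)=t^{p}f_1(t)\ \text{for } t>0,\ \text{for some } p>-1 \text{ and } f_1\in C[0,+\infty)\}.$$ The Laplace convolution is $(f*g)(t) = \int_0^t f(t-\tau)\,g(\tau)\,d\tau$, $t>0$. It is commutative and associative on $C_{-1}(0,+\infty)$ and maps pairs of functions of this space into this space. For $\kappa \in C_{-1}(0,+\infty)$, the general fractional integral (GFI) with kernel $\kappa$ is $$(\mathbb{I}_{(\kappa)}\, f)(t) := (\kappa * f)(t) = \int_0^t \kappa(t-\tau) f(\tau)\,d\tau,\quad t>0,$$ and likewise $\mathbb{I}_{(k_1)} f = k_1 * f$, $\mathbb{I}_{(k_2)} f = k_2 * f$. $\mathcal{L}_1^1$ denotes the set of triples $(\kappa,k_1,k_2)$ of functions in $C_{-1}(0,+\infty)$ such that $(\kappa * k_1 * k_2)(t) = 1$ for all $t>0$ (the 1st level kernels). For $(\kappa,k_1,k_2)\in\mathcal{L}_1^1$,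 the 1st level general fractional derivative (GFD) is $$({}_{1L}\mathbb{D}_{(k_1,k_2)}\, f)(t) := \left(\mathbb{I}_{(k_1)}\, \frac{d}{dt}\, \mathbb{I}_{(k_2)}\, f\right)(t),\quad t>0.$$ The space $C_{-1,(k_2)}^{1}(0,+\infty)$ is $$C_{-1,(k_2)}^{1}(0,+\infty) := \left\{ f\in C_{-1}(0,+\infty):\ \frac{d}{dt}\,\mathbb{I}_{(k_2)}\, f \in C_{-1}(0,+\infty) \right\},$$ where membership includes that $\mathbb{I}_{(k_2)} f$ is differentiable at every $t>0$. The value $(\mathbb{I}_{(k_2)} f)(0)$ is understood as the limit $\lim_{t\to 0+}(\mathbb{I}_{(k_2)} f)(t)$, which exists and is finite for $f \in C_{-1,(k_2)}^{1}(0,+\infty)$ because the derivative of $\mathbb{I}_{(k_2)} f$ lies in $C_{-1}(0,+\infty)$. *)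

theory Defs
  imports "HOL-Analysis.Analysis"
begin

text \<open>
  Functions on the open half-line are represented by total functions on the reals. Only their values
  at positive arguments matter: the values of the notions below at positive arguments, and
  membership in the sets below, do not depend on any others.
\<close>

definition C_minus1 :: "(real \<Rightarrow> real) set" where
  "C_minus1 = {f. \<exists>p f1. p > -1 \<and> continuous_on {0..} f1 \<and> (\<forall>t>0. f t = t powr p * f1 t)}"

text \<open>The interval is open, so neither factor is evaluated at 0 or below.\<close>

definition laplace_conv :: "(real \<Rightarrow> real) \<Rightarrow> (real \<Rightarrow> real) \<Rightarrow> real \<Rightarrow> real" (infixl "\<star>" 70) where
  "(f \<star> g) t = (LBINT \<tau>:{0<..<t}. f (t - \<tau>) * g \<tau>)"

definition GFI :: "(real \<Rightarrow> real) \<Rightarrow> (real \<Rightarrow> real) \<Rightarrow> real \<Rightarrow> real" where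
  "GFI \<kappa> f = \<kappa> \<star> f"

definition level1_kernels :: "((real \<Rightarrow> real) \<times> (real \<Rightarrow> real) \<times> (real \<Rightarrow> real)) set" where
  "level1_kernels = {(\<kappa>, k1, k2). \<kappa> \<in> C_minus1 \<and> k1 \<in> C_minus1 \<and> k2 \<in> C_minus1 \<and>
     (\<forall>t>0. (\<kappa> \<star> k1 \<star> k2) t = 1)}"

definition GFD1 :: "(real \<Rightarrow> real) \<Rightarrow> (real \<Rightarrow> real) \<Rightarrow> (real \<Rightarrow> real) \<Rightarrow> real \<Rightarrow> real" where
  "GFD1 k1 k2 f = GFI k1 (deriv (GFI k2 f))"

definition C1_minus1 :: "(real \<Rightarrow> real) \<Rightarrow> (real \<Rightarrow> real) set" where
  "C1_minus1 k2 = {f \<in> C_minus1. (\<forall>t>0. GFI k2 f differentiable (at t)) \<and>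
     deriv (GFI k2 f) \<in> C_minus1}"

text \<open>
  The initial value of \<^term>\<open>GFI k2 f\<close> is its right limit at 0, not its (always zero) value at
  the argument 0. The lemma below shows that \<^const>\<open>Lim\<close> is meaningful here.
\<close>

definition GFI_init :: "(real \<Rightarrow> real) \<Rightarrow> (real \<Rightarrow> real) \<Rightarrow> real" where
  "GFI_init k2 f = Lim (at_right 0) (GFI k2 f)"

lemma GFI_init_tendsto:
  assumes "f \<in> C1_minus1 k2"
  shows "(GFI k2 f \<longlongrightarrow> GFI_init k2 f) (at_right 0)"
proof -
  define F where "F = GFI k2 f"
  from assms have diff: "\<And>t. t > 0 \<Longrightarrow> F differentiable (at t)" and "deriv F \<in> C_minus1"
    by (auto simp: C1_minus1_def F_def)
  then obtain p f1 where p: "p > -1" and c: "continuous_on {0..} f1"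
    and eq: "\<And>t. t > 0 \<Longrightarrow> deriv F t = t powr p * f1 t"
    unfolding C_minus1_def by blast
  have D: "(F has_real_derivative t powr p * f1 t) (at t)" if "t > 0" for t
    using diff[OF that] eq[OF that]
    by (metis DERIV_imp_deriv real_differentiable_def)
  have "compact (f1 ` {0..1})"
    by (intro compact_continuous_image continuous_on_subset[OF c]) auto
  then obtain M where M: "\<And>t. t \<in> {0..1} \<Longrightarrow> \<bar>f1 t\<bar> \<le> M"
    using compact_imp_bounded bounded_iff by (metis imageI real_norm_def)
  define h where "h t = M / (p + 1) * t powr (p + 1)" for t
  have Dh: "(h has_real_derivative M * t powr p) (at t)" if "t > 0" for t
    unfolding h_def using that p by (auto intro!: derivative_eq_intros)
  have mono1: "F s + h s \<le> F t + h t" if "0 < s" "s \<le> t" "t \<le> 1" for s t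
  proof (rule DERIV_nonneg_imp_nondecreasing[where f = "\<lambda>x. F x + h x", OF that(2)])
    fix x assume "s \<le> x" "x \<le> t"
    then have x: "x > 0" "\<bar>f1 x\<bar> \<le> M" using that M by auto
    then have "0 \<le> x powr p * (f1 x + M)" by (intro mult_nonneg_nonneg) auto
    then show "\<exists>y. ((\<lambda>x. F x + h x) has_real_derivative y) (at x) \<and> 0 \<le> y"
      using DERIV_add[OF D[OF x(1)] Dh[OF x(1)]] by (auto simp: algebra_simps)
  qed
  have mono2: "h s - F s \<le> h t - F t" if "0 < s" "s \<le> t" "t \<le> 1" for s t
  proof (rule DERIV_nonneg_imp_nondecreasing[where f = "\<lambda>x. h x - F x", OF that(2)])
    fix x assume "s \<le> x" "x \<le> t"
    then have x: "x > 0" "\<bar>f1 x\<bar> \<le> M" using that M by auto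
    then have "0 \<le> x powr p * (M - f1 x)" by (intro mult_nonneg_nonneg) auto
    then show "\<exists>y. ((\<lambda>x. h x - F x) has_real_derivative y) (at x) \<and> 0 \<le> y"
      using DERIV_diff[OF Dh[OF x(1)] D[OF x(1)]] by (auto simp: algebra_simps)
  qed
  have "M \<ge> 0" using M[of 0] by auto
  then have h0: "h t \<ge> 0" for t using p by (auto simp: h_def)
  have "((\<lambda>x. F x + h x) \<longlongrightarrow> Inf ((\<lambda>x. F x + h x) ` ({0<..} \<inter> {..1}))) (at 0 within ({0<..} \<inter> {..1}))"
  proof (rule Lim_right_bound)
    fix a b :: real assume "a \<in> {..1}" "b \<in> {..1}" "0 < a" "a \<le> b"
    then show "F a + h a \<le> F b + h b" using mono1 by auto
  next
    fix a :: real assume "a \<in> {..1}" "0 < a"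
    then show "F 1 - h 1 \<le> F a + h a" using mono2[of a 1] h0[of a] by auto
  qed
  moreover have "at 0 within ({0<..} \<inter> {..1}) = at_right (0::real)"
    by (rule at_within_nhd[of _ "{-1<..<1}"]) auto
  ultimately obtain L where L: "((\<lambda>x. F x + h x) \<longlongrightarrow> L) (at_right 0)" by auto
  have "((\<lambda>t. t powr (p + 1)) \<longlongrightarrow> 0) (at_right (0::real))"
    using p tendsto_powr'[of "\<lambda>t. t" 0 "at_right (0::real)" "\<lambda>_. p + 1" "p + 1"]
    by (auto simp: eventually_at_filter)
  then have "(h \<longlongrightarrow> 0) (at_right 0)"
    unfolding h_def by (rule tendsto_mult_right_zero)
  from tendsto_diff[OF L this] have FL: "(F \<longlongrightarrow> L) (at_right 0)" by simp
  then have "Lim (at_right 0) F = L" by (intro tendsto_Lim) auto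
  with FL show ?thesis by (simp add: GFI_init_def F_def)
qed

end

theory Submission
  imports Defs
begin

text \<open>
  Put \<^term>\<open>h = \<kappa> \<star> k1\<close>, let \<^term>\<open>F = k2 \<star> f\<close>, and let \<open>g\<close> be its derivative and \<open>c\<close> its limit at
  0 from the right, so that \<open>F = c + 1 \<star> g\<close> on the positive half-line. By associativity the left-hand
  side of the theorem is \<open>h \<star> g\<close>, and the kernel condition says \<open>h \<star> k2 = 1\<close>. Computing \<open>h \<star> F\<close> in two
  ways gives
  \<open>1 \<star> f = (h \<star> k2) \<star> f = h \<star> F = h \<star> (c + 1 \<star> g) = 1 \<star> (c h + h \<star> g)\<close>.
  Convolution with 1 is integration from 0, so \<open>f\<close> and \<open>c h + h \<star> g\<close> have the same integral over
  every interval \<open>(0, t)\<close>. Both functions are continuous on the open half-line, hence they agree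
  at every \<open>t > 0\<close>.

  The argument has to work at every point and not only almost everywhere. It is therefore carried
  out in the class of functions that are continuous on the open half-line and integrable near 0.
  This class contains \<^const>\<open>C_minus1\<close>. It is closed under convolution (\<open>conv_in_cont_loc_int\<close>),
  and in it convolution is commutative and associative at every point (\<open>conv_commute\<close>,
  \<open>conv_assoc\<close>). The absolute values of its members belong to it as well, which is what makes
  Fubini's theorem available at each fixed \<open>t\<close>. Continuity of the convolution follows by
  cutting its integral at the midpoint of \<open>(0, t)\<close>, which separates the two possible singularities.
\<close>

section \<open>Continuous functions on the half-line that are integrable near 0\<close>

definition cont_loc_int :: "(real \<Rightarrow> real) set" where
  "cont_loc_int = {f. continuous_on {0<..} f \<and> (\<forall>T. set_integrable lborel {0<..<T} f)}"

lemma cont_loc_int_cont: "f \<in> cont_loc_int \<Longrightarrow> continuous_on {0<..} f"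
  and cont_loc_int_integrable: "f \<in> cont_loc_int \<Longrightarrow> set_integrable lborel {0<..<T} f"
  by (auto simp: cont_loc_int_def)

lemma cont_loc_int_abs: "f \<in> cont_loc_int \<Longrightarrow> (\<lambda>x. \<bar>f x\<bar>) \<in> cont_loc_int"
  by (auto simp: cont_loc_int_def intro!: continuous_intros set_integrable_abs)

lemma cont_loc_int_const: "(\<lambda>x. c) \<in> cont_loc_int"
proof -
  have "set_integrable lborel {0<..<T} (\<lambda>x. c)" for T :: real
    by (rule set_integrable_subset[of _ "{0..T}"])
       (auto intro: borel_integrable_atLeastAtMost')
  then show ?thesis by (auto simp: cont_loc_int_def)
qed

lemma cont_loc_int_cmult: "f \<in> cont_loc_int \<Longrightarrow> (\<lambda>x. c * f x) \<in> cont_loc_int"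
  by (auto simp: cont_loc_int_def intro!: continuous_intros)

lemma cont_loc_int_diff:
  "f \<in> cont_loc_int \<Longrightarrow> g \<in> cont_loc_int \<Longrightarrow> (\<lambda>x. f x - g x) \<in> cont_loc_int"
  by (auto simp: cont_loc_int_def intro!: continuous_intros set_integral_diff)

text \<open>
  Near 0 the continuous factor is bounded, and a power with exponent above \<open>-1\<close> is integrable
  because its antiderivative has a finite limit at 0.
\<close>

lemma C_minus1_subset: "C_minus1 \<subseteq> cont_loc_int"
proof
  fix f assume "f \<in> C_minus1"
  then obtain p f1 where p: "p > -1" and c: "continuous_on {0..} f1"
    and eq: "\<And>t. t > 0 \<Longrightarrow> f t = t powr p * f1 t"
    unfolding C_minus1_def by blast
  have "continuous_on {0<..} (\<lambda>t. t powr p * f1 t)"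
    by (intro continuous_intros continuous_on_subset[OF c]) auto
  then have cf: "continuous_on {0<..} f"
    by (rule continuous_on_eq) (simp add: eq)
  have "set_integrable lborel {0<..<T} f" for T
  proof (cases "T > 0")
    case False
    then show ?thesis by (simp add: set_integrable_def)
  next
    case True
    have "set_integrable lborel (einterval (ereal 0) (ereal T)) (\<lambda>x. x powr p)"
    proof (rule interval_integral_FTC_nonneg(1)[where F = "\<lambda>x. x powr (p + 1) / (p + 1)"])
      show "((\<lambda>x. x powr (p + 1) / (p + 1)) has_real_derivative x powr p) (at x)"
        if "ereal 0 < ereal x" for x
        using that p by (auto intro!: derivative_eq_intros)
      show "isCont (\<lambda>x. x powr p) x" if "ereal 0 < ereal x" for x
        using that by (auto intro!: continuous_intros)
      have "((\<lambda>t. t powr (p + 1)) \<longlongrightarrow> 0) (at_right (0::real))"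
        using p tendsto_powr'[of "\<lambda>t. t" 0 "at_right (0::real)" "\<lambda>_. p + 1" "p + 1"]
        by (auto simp: eventually_at_filter)
      then show "(((\<lambda>x. x powr (p + 1) / (p + 1)) \<circ> real_of_ereal) \<longlongrightarrow> 0) (at_right (ereal 0))"
        unfolding ereal_tendsto_simps using tendsto_divide_zero by blast
      show "(((\<lambda>x. x powr (p + 1) / (p + 1)) \<circ> real_of_ereal) \<longlongrightarrow> T powr (p + 1) / (p + 1))
          (at_left (ereal T))"
        unfolding ereal_tendsto_simps using True p by (intro tendsto_intros) auto
    qed (use True in auto)
    then have i: "set_integrable lborel {0<..<T} (\<lambda>x. x powr p)" by simp
    have "compact (f1 ` {0..T})"
      by (intro compact_continuous_image continuous_on_subset[OF c]) auto
    then obtain M where M: "\<And>t. t \<in> {0..T} \<Longrightarrow> \<bar>f1 t\<bar> \<le> M"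
      using compact_imp_bounded bounded_iff by (metis imageI real_norm_def)
    have "set_integrable lborel {0<..<T} (\<lambda>x. M * x powr p)" using i by simp
    then show ?thesis
    proof (rule set_integrable_bound)
      show "set_borel_measurable lborel {0<..<T} f"
        using borel_measurable_continuous_on_indicator[OF _ continuous_on_subset[OF cf], of "{0<..<T}"]
        by (auto simp: set_borel_measurable_def subset_eq)
      show "AE x in lborel. x \<in> {0<..<T} \<longrightarrow> norm (f x) \<le> norm (M * x powr p)"
      proof (intro AE_I2 impI)
        fix x assume "x \<in> {0<..<T}"
        then have x: "x > 0" "\<bar>f1 x\<bar> \<le> \<bar>M\<bar>" using M[of x] by auto
        then show "norm (f x) \<le> norm (M * x powr p)"
          by (simp add: eq abs_mult mult.commute mult_left_mono)
      qed
    qed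
  qed
  with cf show "f \<in> cont_loc_int" by (simp add: cont_loc_int_def)
qed

section \<open>Commutativity and integrability of the convolution integrand\<close>

text \<open>
  Extension by zero turns the Laplace convolution into an integral over the whole line
  (\<open>conv_causal\<close>), where substitutions and Fubini's theorem need no bookkeeping of limits.
\<close>

definition causal :: "(real \<Rightarrow> real) \<Rightarrow> real \<Rightarrow> real" where
  "causal f t = indicator {0<..} t * f t"

lemma causal_pos: "t > 0 \<Longrightarrow> causal f t = f t"
  and causal_neg: "t \<le> 0 \<Longrightarrow> causal f t = 0"
  by (auto simp: causal_def)

lemma causal_measurable:
  assumes "f \<in> cont_loc_int"
  shows "causal f \<in> borel_measurable borel"
  using borel_measurable_continuous_on_indicator[OF _ cont_loc_int_cont[OF assms]]
  by (simp add: causal_def[abs_def])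

lemma conv_causal: "(f \<star> g) t = (\<integral>\<tau>. causal f (t - \<tau>) * causal g \<tau> \<partial>lborel)"
  unfolding laplace_conv_def set_lebesgue_integral_def
  by (rule Bochner_Integration.integral_cong) (auto simp: causal_def split: split_indicator)

lemma conv_nonpos: "t \<le> 0 \<Longrightarrow> (f \<star> g) t = 0"
  by (simp add: laplace_conv_def set_lebesgue_integral_def)

lemma conv_cong:
  assumes "\<And>t. t > 0 \<Longrightarrow> f t = f' t" "\<And>t. t > 0 \<Longrightarrow> g t = g' t"
  shows "(f \<star> g) t = (f' \<star> g') t"
  unfolding laplace_conv_def by (rule set_lebesgue_integral_cong) (auto simp: assms)

lemma conv_commute: "f \<star> g = g \<star> f"
proof
  fix t
  have "(f \<star> g) t = (\<integral>\<tau>. causal f (t - (t + (-1) * \<tau>)) * causal g (t + (-1) * \<tau>) \<partial>lborel)"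
    unfolding conv_causal by (subst lborel_integral_real_affine[where c = "-1" and t = t]) auto
  also have "\<dots> = (g \<star> f) t"
    unfolding conv_causal by (simp add: mult.commute)
  finally show "(f \<star> g) t = (g \<star> f) t" .
qed

text \<open>
  The integrand of a convolution may be singular at both ends of \<open>(0, t)\<close>. Cutting at the midpoint
  leaves one singular and one bounded factor on each half, and the second half becomes the first one
  with the two functions exchanged.
\<close>

definition half_integrand :: "(real \<Rightarrow> real) \<Rightarrow> (real \<Rightarrow> real) \<Rightarrow> real \<Rightarrow> real \<Rightarrow> real" where
  "half_integrand f g t \<tau> = indicator {0<..<t/2} \<tau> * (causal f (t - \<tau>) * causal g \<tau>)"

lemma half_integrand_measurable:
  assumes "f \<in> cont_loc_int" "g \<in> cont_loc_int"
  shows "half_integrand f g t \<in> borel_measurable lborel"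
proof -
  note [measurable] = assms[THEN causal_measurable]
  show ?thesis unfolding half_integrand_def[abs_def] by measurable
qed

text \<open>
  One integrable bound serves all \<open>t\<close> in \<open>(r, 2r)\<close>: there the argument of the bounded factor stays in
  \<open>[r/2, 2r]\<close>. Since these intervals cover the open half-line, the bound gives integrability and, by
  dominated convergence, continuity.
\<close>

lemma half_integrand_bound:
  assumes f: "f \<in> cont_loc_int" and g: "g \<in> cont_loc_int" and r: "r > 0"
  obtains w where "integrable lborel w"
    "\<And>t \<tau>. t \<in> {r<..<2*r} \<Longrightarrow> norm (half_integrand f g t \<tau>) \<le> w \<tau>"
proof -
  have "compact (f ` {r/2..2*r})"
    using r by (intro compact_continuous_image continuous_on_subset[OF cont_loc_int_cont[OF f]]) auto
  then obtain M where M: "\<And>t. t \<in> {r/2..2*r} \<Longrightarrow> \<bar>f t\<bar> \<le> M"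
    using compact_imp_bounded bounded_iff by (metis imageI real_norm_def)
  define w where "w \<tau> = M * norm (indicator {0<..<r} \<tau> *\<^sub>R g \<tau>)" for \<tau>
  have "M \<ge> 0" using M[of r] r by auto
  have "integrable lborel w"
    using cont_loc_int_integrable[OF g, of r] unfolding w_def set_integrable_def
    by (intro integrable_mult_right integrable_norm)
  moreover have "norm (half_integrand f g t \<tau>) \<le> w \<tau>" if t: "t \<in> {r<..<2*r}" for t \<tau>
  proof (cases "\<tau> \<in> {0<..<t/2}")
    case True
    with t have "t - \<tau> \<in> {r/2..2*r}" "\<tau> \<in> {0<..<r}" "t - \<tau> > 0" by auto
    then show ?thesis
      using True M[of "t - \<tau>"]
      by (simp add: half_integrand_def w_def causal_pos abs_mult mult_right_mono)
  next
    case False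
    then show ?thesis using \<open>M \<ge> 0\<close> by (simp add: half_integrand_def w_def)
  qed
  ultimately show ?thesis using that by blast
qed

lemma half_integrand_integrable:
  assumes "f \<in> cont_loc_int" "g \<in> cont_loc_int"
  shows "integrable lborel (half_integrand f g t)"
proof (cases "t > 0")
  case False
  then have "half_integrand f g t = (\<lambda>_. 0)" by (auto simp: half_integrand_def)
  then show ?thesis by simp
next
  case True
  obtain w where w: "integrable lborel w"
    "\<And>s \<tau>. s \<in> {2*t/3<..<2*(2*t/3)} \<Longrightarrow> norm (half_integrand f g s \<tau>) \<le> w \<tau>"
    \<comment> \<open>With \<open>r = 2t/3\<close> the point \<open>t\<close> is interior to \<open>(r, 2r)\<close>.\<close>
    using half_integrand_bound[OF assms, of "2*t/3"] True by auto
  show ?thesis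
  proof (rule Bochner_Integration.integrable_bound[OF w(1) half_integrand_measurable[OF assms]])
    have "norm (half_integrand f g t \<tau>) \<le> norm (w \<tau>)" for \<tau>
      using w(2)[of t \<tau>] True by simp
    then show "AE \<tau> in lborel. norm (half_integrand f g t \<tau>) \<le> norm (w \<tau>)" by simp
  qed
qed

text \<open>
  Reflection exchanges the two halves; the midpoint belongs to neither of them, whence the
  almost-everywhere qualification.
\<close>

lemma AE_integrand_split:
  "AE \<tau> in lborel. causal f (t - \<tau>) * causal g \<tau> =
     half_integrand f g t \<tau> + half_integrand g f t (t + (-1) * \<tau>)"
  using AE_lborel_singleton[of "t/2"]
proof eventually_elim
  fix \<tau> assume "\<tau> \<noteq> t/2"
  then consider "\<tau> \<le> 0" | "0 < \<tau>" "\<tau> < t/2" | "t/2 < \<tau>" "\<tau> < t" | "t \<le> \<tau>"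
    by linarith
  then show "causal f (t - \<tau>) * causal g \<tau> =
      half_integrand f g t \<tau> + half_integrand g f t (t + (-1) * \<tau>)"
    by cases (simp_all add: half_integrand_def causal_neg)
qed

lemma conv_integrable:
  assumes "f \<in> cont_loc_int" "g \<in> cont_loc_int"
  shows "integrable lborel (\<lambda>\<tau>. causal f (t - \<tau>) * causal g \<tau>)"
proof -
  note [measurable] = assms[THEN causal_measurable]
  have "integrable lborel (\<lambda>\<tau>. half_integrand f g t \<tau> + half_integrand g f t (t + (-1) * \<tau>))"
    using assms
    by (intro Bochner_Integration.integrable_add half_integrand_integrable
        lborel_integrable_real_affine) auto
  then show ?thesis
    by (rule integrable_cong_AE_imp) (use AE_integrand_split in \<open>auto simp: eq_commute\<close>)
qed

lemma conv_split_halves: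
  assumes "f \<in> cont_loc_int" "g \<in> cont_loc_int"
  shows "(f \<star> g) t = integral\<^sup>L lborel (half_integrand f g t) + integral\<^sup>L lborel (half_integrand g f t)"
proof -
  note [measurable] = assms[THEN causal_measurable] half_integrand_measurable[OF assms]
    half_integrand_measurable[OF assms(2,1)]
  have i: "integrable lborel (\<lambda>\<tau>. half_integrand g f t (t + (-1) * \<tau>))"
    using half_integrand_integrable[OF assms(2,1)] by (rule lborel_integrable_real_affine) auto
  have "(f \<star> g) t = (\<integral>\<tau>. half_integrand f g t \<tau> + half_integrand g f t (t + (-1) * \<tau>) \<partial>lborel)"
    unfolding conv_causal by (rule integral_cong_AE) (use AE_integrand_split in auto)
  also have "\<dots> = integral\<^sup>L lborel (half_integrand f g t)
      + (\<integral>\<tau>. half_integrand g f t (t + (-1) * \<tau>) \<partial>lborel)"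
    by (rule Bochner_Integration.integral_add[OF half_integrand_integrable[OF assms] i])
  also have "(\<integral>\<tau>. half_integrand g f t (t + (-1) * \<tau>) \<partial>lborel) = integral\<^sup>L lborel (half_integrand g f t)"
    by (subst (2) lborel_integral_real_affine[where c = "-1" and t = t]) auto
  finally show ?thesis .
qed

lemma conv_add_right:
  assumes "h \<in> cont_loc_int" "f \<in> cont_loc_int" "g \<in> cont_loc_int"
  shows "(h \<star> (\<lambda>x. f x + g x)) t = (h \<star> f) t + (h \<star> g) t"
proof -
  have "(h \<star> (\<lambda>x. f x + g x)) t =
      (\<integral>\<tau>. causal h (t - \<tau>) * causal f \<tau> + causal h (t - \<tau>) * causal g \<tau> \<partial>lborel)"
    unfolding conv_causal by (rule Bochner_Integration.integral_cong) (auto simp: causal_def algebra_simps)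
  also have "\<dots> = (h \<star> f) t + (h \<star> g) t"
    unfolding conv_causal using assms by (intro Bochner_Integration.integral_add conv_integrable)
  finally show ?thesis .
qed

section \<open>Closure under convolution\<close>

lemma half_integral_continuous:
  assumes f: "f \<in> cont_loc_int" and g: "g \<in> cont_loc_int"
  shows "continuous_on {0<..} (\<lambda>t. integral\<^sup>L lborel (half_integrand f g t))"
proof -
  let ?I = "\<lambda>t. integral\<^sup>L lborel (half_integrand f g t)"
  have local_cont: "continuous_on {r<..<2*r} ?I" if r: "r > 0" for r
  proof (rule continuous_on_sequentiallyI)
    fix u a assume u: "\<forall>n. u n \<in> {r<..<2*r}" and a: "a \<in> {r<..<2*r}" and lim: "u \<longlonglongrightarrow> a"
    obtain w where w: "integrable lborel w"
      "\<And>t \<tau>. t \<in> {r<..<2*r} \<Longrightarrow> norm (half_integrand f g t \<tau>) \<le> w \<tau>"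
      using half_integrand_bound[OF f g r] by blast
    show "(\<lambda>n. ?I (u n)) \<longlonglongrightarrow> ?I a"
    proof (rule integral_dominated_convergence[where w = w])
      \<comment> \<open>The indicator jumps at the midpoint, so convergence may fail at that single point.\<close>
      show "AE \<tau> in lborel. (\<lambda>n. half_integrand f g (u n) \<tau>) \<longlonglongrightarrow> half_integrand f g a \<tau>"
        using AE_lborel_singleton[of "a/2"]
      proof eventually_elim
        fix \<tau> assume "\<tau> \<noteq> a/2"
        then consider "\<tau> \<le> 0" | "0 < \<tau>" "\<tau> < a/2" | "a/2 < \<tau>" by linarith
        then show "(\<lambda>n. half_integrand f g (u n) \<tau>) \<longlonglongrightarrow> half_integrand f g a \<tau>"
        proof cases
          case 1
          then show ?thesis by (simp add: half_integrand_def)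
        next
          case 2
          have "eventually (\<lambda>n. 2*\<tau> < u n) sequentially"
            using order_tendstoD(1)[OF lim, of "2*\<tau>"] 2 by auto
          then have ev: "eventually (\<lambda>n. f (u n - \<tau>) * g \<tau> = half_integrand f g (u n) \<tau>) sequentially"
            by eventually_elim (use 2 in \<open>auto simp: half_integrand_def causal_pos\<close>)
          have "isCont f (a - \<tau>)"
            using cont_loc_int_cont[OF f] 2 by (simp add: continuous_on_eq_continuous_at)
          then have "(\<lambda>n. f (u n - \<tau>)) \<longlonglongrightarrow> f (a - \<tau>)"
            by (rule isCont_tendsto_compose) (intro tendsto_intros lim)
          then have "(\<lambda>n. f (u n - \<tau>) * g \<tau>) \<longlonglongrightarrow> half_integrand f g a \<tau>"
            using 2 by (auto simp: half_integrand_def causal_pos intro!: tendsto_intros)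
          then show ?thesis by (rule Lim_transform_eventually[OF _ ev])
        next
          case 3
          have "eventually (\<lambda>n. u n < 2*\<tau>) sequentially"
            using order_tendstoD(2)[OF lim, of "2*\<tau>"] 3 by auto
          then have ev: "eventually (\<lambda>n. 0 = half_integrand f g (u n) \<tau>) sequentially"
            by eventually_elim (auto simp: half_integrand_def)
          have "(\<lambda>n. 0) \<longlonglongrightarrow> half_integrand f g a \<tau>"
            using 3 by (simp add: half_integrand_def)
          then show ?thesis by (rule Lim_transform_eventually[OF _ ev])
        qed
      qed
    qed (use w u half_integrand_measurable[OF f g] in auto)
  qed
  have "isCont ?I t" if "t > 0" for t
    using local_cont[of "2*t/3"] that by (simp add: continuous_on_eq_continuous_at)
  then show ?thesis by (simp add: continuous_on_eq_continuous_at)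
qed

text \<open>
  Integrability near 0 is the inequality between the \<open>L\<^sup>1\<close> norm of a convolution and the product of
  the \<open>L\<^sup>1\<close> norms: below \<open>T\<close> the convolution only sees the restrictions of both functions to \<open>(0, T)\<close>.
\<close>

lemma conv_set_integrable:
  assumes f: "f \<in> cont_loc_int" and g: "g \<in> cont_loc_int"
  shows "set_integrable lborel {0<..<T} (f \<star> g)"
proof -
  define fT where "fT x = indicator {0<..<T} x * f x" for x
  define gT where "gT x = indicator {0<..<T} x * g x" for x
  have fi: "integrable lborel fT" and gi: "integrable lborel gT"
    using cont_loc_int_integrable[OF f, of T] cont_loc_int_integrable[OF g, of T]
    by (auto simp: fT_def[abs_def] gT_def[abs_def] set_integrable_def)
  then have [measurable]: "fT \<in> borel_measurable borel" "gT \<in> borel_measurable borel"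
    by (auto dest: borel_measurable_integrable)
  have fshift: "integrable lborel (\<lambda>t. fT (t - \<tau>))" for \<tau>
    using lborel_integrable_real_affine[OF fi, of 1 "-\<tau>"] by (simp add: algebra_simps)
  have norm_shift: "(\<integral>t. \<bar>fT (t - \<tau>)\<bar> \<partial>lborel) = (\<integral>t. \<bar>fT t\<bar> \<partial>lborel)" for \<tau>
    by (subst (2) lborel_integral_real_affine[where c = 1 and t = "-\<tau>"]) (auto simp: algebra_simps)
  have "integrable (lborel \<Otimes>\<^sub>M lborel) (\<lambda>(\<tau>, t). gT \<tau> * fT (t - \<tau>))"
  proof (rule lborel_pair.Fubini_integrable)
    have "(\<integral>t. norm (gT \<tau> * fT (t - \<tau>)) \<partial>lborel) = \<bar>gT \<tau>\<bar> * (\<integral>t. \<bar>fT t\<bar> \<partial>lborel)" for \<tau>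
      by (simp add: abs_mult norm_shift)
    then show "integrable lborel (\<lambda>\<tau>. \<integral>t. norm (case (\<tau>, t) of (\<tau>, t) \<Rightarrow> gT \<tau> * fT (t - \<tau>)) \<partial>lborel)"
      using gi by simp
  qed (use fshift in auto)
  then have "integrable lborel (\<lambda>t. \<integral>\<tau>. gT \<tau> * fT (t - \<tau>) \<partial>lborel)"
    by (rule lborel_pair.integrable_snd)
  then have "set_integrable lborel {0<..<T} (\<lambda>t. \<integral>\<tau>. gT \<tau> * fT (t - \<tau>) \<partial>lborel)"
    unfolding set_integrable_def by (rule integrable_mult_indicator[rotated]) auto
  moreover have "(f \<star> g) t = (\<integral>\<tau>. gT \<tau> * fT (t - \<tau>) \<partial>lborel)" if "t \<in> {0<..<T}" for t
    unfolding conv_causal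
    by (rule Bochner_Integration.integral_cong)
       (use that in \<open>auto simp: causal_def fT_def gT_def split: split_indicator\<close>)
  ultimately show ?thesis
    by (subst set_integrable_cong[OF refl refl]) auto
qed

lemma conv_in_cont_loc_int:
  assumes "f \<in> cont_loc_int" "g \<in> cont_loc_int"
  shows "f \<star> g \<in> cont_loc_int"
proof -
  have "continuous_on {0<..} (f \<star> g)"
    using half_integral_continuous[OF assms] half_integral_continuous[OF assms(2,1)]
    by (subst conv_split_halves[OF assms, THEN ext, unfolded eta_contract_eq])
       (intro continuous_on_add)
  then show ?thesis by (simp add: cont_loc_int_def conv_set_integrable[OF assms])
qed

section \<open>Associativity\<close>

text \<open>
  Both sides are iterated integrals of \<open>f(t - \<rho>) g(\<rho> - \<tau>) h(\<tau>)\<close>, in opposite orders. The integrability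
  required by Fubini's theorem at the given \<open>t\<close> is that of the integrand of \<open>((|f| \<star> |g|) \<star> |h|)(t)\<close>,
  where \<open>|f| \<star> |g|\<close> belongs to the class again.
\<close>

lemma conv_assoc:
  assumes f: "f \<in> cont_loc_int" and g: "g \<in> cont_loc_int" and h: "h \<in> cont_loc_int"
  shows "f \<star> g \<star> h = f \<star> (g \<star> h)"
proof
  fix t
  note [measurable] = assms[THEN causal_measurable]
  have shift: "(\<lambda>\<sigma>. causal u (t - \<tau> - \<sigma>) * causal v \<sigma>) = (\<lambda>\<sigma>. causal u (t - (\<tau> + 1 * \<sigma>)) * causal v ((\<tau> + 1 * \<sigma>) - \<tau>))"
    for u v \<tau> by (auto simp: algebra_simps)
  have inner: "(u \<star> v) (t - \<tau>) = (\<integral>\<rho>. causal u (t - \<rho>) * causal v (\<rho> - \<tau>) \<partial>lborel)" for u v \<tau>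
    unfolding conv_causal shift
    by (subst (2) lborel_integral_real_affine[where c = 1 and t = \<tau>]) auto
  have inner_integrable: "integrable lborel (\<lambda>\<rho>. causal f (t - \<rho>) * causal g (\<rho> - \<tau>))" for \<tau>
    using lborel_integrable_real_affine[OF conv_integrable[OF f g, of "t - \<tau>"], of 1 "-\<tau>"]
    by (simp add: algebra_simps)
  have causal_conv: "causal (u \<star> v) x = (u \<star> v) x" for u v x
    by (cases "x > 0") (auto simp: causal_pos causal_neg conv_nonpos)
  have causal_abs: "\<bar>causal u x\<bar> = causal (\<lambda>x. \<bar>u x\<bar>) x" for u x
    by (auto simp: causal_def split: split_indicator)
  have "integrable (lborel \<Otimes>\<^sub>M lborel) (\<lambda>(\<tau>, \<rho>). causal f (t - \<rho>) * causal g (\<rho> - \<tau>) * causal h \<tau>)"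
  proof (rule lborel_pair.Fubini_integrable)
    let ?a = "\<lambda>u x. \<bar>u x\<bar> :: real"
    have "(\<integral>\<rho>. norm (causal f (t - \<rho>) * causal g (\<rho> - \<tau>) * causal h \<tau>) \<partial>lborel)
        = causal (?a f \<star> ?a g) (t - \<tau>) * causal (?a h) \<tau>" for \<tau>
      by (simp add: abs_mult causal_conv inner causal_abs)
    moreover have "integrable lborel (\<lambda>\<tau>. causal (?a f \<star> ?a g) (t - \<tau>) * causal (?a h) \<tau>)"
      by (intro conv_integrable conv_in_cont_loc_int cont_loc_int_abs assms)
    ultimately show "integrable lborel (\<lambda>\<tau>. \<integral>\<rho>. norm (case (\<tau>, \<rho>) of (\<tau>, \<rho>) \<Rightarrow>
        causal f (t - \<rho>) * causal g (\<rho> - \<tau>) * causal h \<tau>) \<partial>lborel)"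
      by simp
    show "AE \<tau> in lborel. integrable lborel (\<lambda>\<rho>. case (\<tau>, \<rho>) of (\<tau>, \<rho>) \<Rightarrow>
        causal f (t - \<rho>) * causal g (\<rho> - \<tau>) * causal h \<tau>)"
      using inner_integrable by auto
  qed measurable
  from lborel_pair.Fubini_integral[OF this]
  have swap: "(\<integral>\<tau>. \<integral>\<rho>. causal f (t - \<rho>) * causal g (\<rho> - \<tau>) * causal h \<tau> \<partial>lborel \<partial>lborel)
      = (\<integral>\<rho>. \<integral>\<tau>. causal f (t - \<rho>) * causal g (\<rho> - \<tau>) * causal h \<tau> \<partial>lborel \<partial>lborel)"
    by simp
  have "(f \<star> g \<star> h) t = (\<integral>\<tau>. (f \<star> g) (t - \<tau>) * causal h \<tau> \<partial>lborel)"
    by (subst conv_causal) (simp add: causal_conv)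
  also have "\<dots> = (\<integral>\<tau>. \<integral>\<rho>. causal f (t - \<rho>) * causal g (\<rho> - \<tau>) * causal h \<tau> \<partial>lborel \<partial>lborel)"
    by (simp add: inner)
  also note swap
  also have "(\<integral>\<rho>. \<integral>\<tau>. causal f (t - \<rho>) * causal g (\<rho> - \<tau>) * causal h \<tau> \<partial>lborel \<partial>lborel)
      = (\<integral>\<rho>. causal f (t - \<rho>) * (g \<star> h) \<rho> \<partial>lborel)"
    by (simp add: mult.assoc conv_causal)
  also have "\<dots> = (f \<star> (g \<star> h)) t"
    by (subst (2) conv_causal) (simp add: causal_conv)
  finally show "(f \<star> g \<star> h) t = (f \<star> (g \<star> h)) t" .
qed

section \<open>Convolution with the constant 1\<close>

lemma conv_one: "((\<lambda>_. 1) \<star> f) t = (LBINT \<tau>:{0<..<t}. f \<tau>)"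
  by (simp add: laplace_conv_def)

text \<open>
  The integral over \<open>(0, u)\<close> is differentiated after subtracting the one over \<open>(0, t/2)\<close>, because
  \<open>w\<close> may be unbounded at 0 and the fundamental theorem needs continuity on a closed interval.
\<close>

lemma eq_0_if_integrals_eq_0:
  assumes w: "w \<in> cont_loc_int"
    and zero: "\<And>t. t > 0 \<Longrightarrow> (LBINT \<tau>:{0<..<t}. w \<tau>) = 0"
    and t: "t > 0"
  shows "w t = 0"
proof -
  have zero': "(LBINT y=ereal 0..ereal x. w y) = 0" if "x > 0" for x
    using zero[OF that] that by (simp add: interval_lebesgue_integral_def)
  have "(LBINT y=ereal (t/2)..ereal x. w y) = 0" if "x > 0" for x
  proof -
    have "(LBINT y=ereal 0..ereal (t/2). w y) + (LBINT y=ereal (t/2)..ereal x. w y)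
        = (LBINT y=ereal 0..ereal x. w y)"
    proof (rule interval_integral_sum)
      have "min (ereal 0) (min (ereal (t/2)) (ereal x)) = ereal 0"
        "max (ereal 0) (max (ereal (t/2)) (ereal x)) = ereal (max (t/2) x)"
        using t that by (simp_all add: min_def max_def)
      then show "interval_lebesgue_integrable lborel (min (ereal 0) (min (ereal (t/2)) (ereal x)))
          (max (ereal 0) (max (ereal (t/2)) (ereal x))) w"
        using cont_loc_int_integrable[OF w] t that
        by (simp add: interval_lebesgue_integrable_def del: ereal_max)
    qed
    then show ?thesis using zero'[of x] zero'[of "t/2"] that t by simp
  qed
  then have const: "0 = (LBINT y=ereal (t/2)..ereal u. w y)" if "u \<in> {t/2..2*t}" for u
    using t that by simp
  have D: "((\<lambda>u. LBINT y=ereal (t/2)..ereal u. w y) has_vector_derivative w t) (at t within {t/2..2*t})"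
    using t by (intro interval_integral_FTC2 continuous_on_subset[OF cont_loc_int_cont[OF w]]) auto
  have "t \<in> {t/2..2*t}" using t by simp
  from has_vector_derivative_transform[OF this const D]
  have "((\<lambda>u. 0) has_vector_derivative w t) (at t within {t/2..2*t})" .
  then have "((\<lambda>u. 0) has_real_derivative w t) (at t)"
    using t by (simp add: at_within_Icc_at has_real_derivative_iff_has_vector_derivative)
  then show ?thesis using DERIV_unique DERIV_const by blast
qed

text \<open>
  This is the fundamental theorem of calculus from 0. The initial value enters as the right limit
  because the derivative may be unbounded at 0.
\<close>

lemma GFI_eq_init_plus_integral:
  assumes f: "f \<in> C1_minus1 k" and t: "t > 0"
  shows "GFI k f t = GFI_init k f + ((\<lambda>_. 1) \<star> deriv (GFI k f)) t"
proof -
  let ?F = "GFI k f"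
  let ?g = "deriv ?F"
  have g: "?g \<in> cont_loc_int" using f C_minus1_subset by (auto simp: C1_minus1_def)
  have D: "(?F has_real_derivative ?g x) (at x)" if "x > 0" for x
    using f that by (auto simp: C1_minus1_def DERIV_deriv_iff_real_differentiable)
  have "(LBINT x=ereal 0..ereal t. ?g x) = ?F t - GFI_init k f"
  proof (rule interval_integral_FTC_integrable)
    show "set_integrable lborel (einterval (ereal 0) (ereal t)) ?g"
      using cont_loc_int_integrable[OF g] by simp
    show "isCont ?g x" if "ereal 0 < ereal x" for x
      using cont_loc_int_cont[OF g] that by (simp add: continuous_on_eq_continuous_at)
    show "((?F \<circ> real_of_ereal) \<longlongrightarrow> GFI_init k f) (at_right (ereal 0))"
      unfolding ereal_tendsto_simps by (rule GFI_init_tendsto[OF f])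
    have "isCont ?F t" using D[OF t] by (rule DERIV_isCont)
    then show "((?F \<circ> real_of_ereal) \<longlongrightarrow> ?F t) (at_left (ereal t))"
      unfolding ereal_tendsto_simps isCont_def by (rule tendsto_within_subset) auto
  qed (use D t in \<open>auto simp: has_real_derivative_iff_has_vector_derivative\<close>)
  then show ?thesis
    using t by (simp add: conv_one interval_lebesgue_integral_def)
qed

section \<open>The composition of the integral with the derivative\<close>

theorem theorem3p2:
  fixes \<kappa> k1 k2 :: "real \<Rightarrow> real"
  assumes "(\<kappa>, k1, k2) \<in> level1_kernels"
  shows "\<forall>f \<in> C1_minus1 k2. \<forall>t>0.
    GFI \<kappa> (GFD1 k1 k2 f) t = f t - GFI_init k2 f * (k1 \<star> \<kappa>) t"
proof (intro ballI allI impI)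
  fix f and t :: real assume f: "f \<in> C1_minus1 k2" and t: "t > 0"
  from assms have K: "\<kappa> \<in> cont_loc_int" "k1 \<in> cont_loc_int" "k2 \<in> cont_loc_int"
    and one: "\<And>t. t > 0 \<Longrightarrow> (\<kappa> \<star> k1 \<star> k2) t = 1"
    using C_minus1_subset by (auto simp: level1_kernels_def)
  define h where "h = \<kappa> \<star> k1"
  define F where "F = GFI k2 f"
  define g where "g = deriv F"
  define c where "c = GFI_init k2 f"
  let ?one = "\<lambda>_. 1 :: real"
  have fK: "f \<in> cont_loc_int" and gK: "g \<in> cont_loc_int"
    using f C_minus1_subset by (auto simp: C1_minus1_def F_def g_def)
  have hK: "h \<in> cont_loc_int" unfolding h_def by (intro conv_in_cont_loc_int K)
  have hgK: "h \<star> g \<in> cont_loc_int" by (intro conv_in_cont_loc_int hK gK)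
  have oneK: "?one \<in> cont_loc_int" by (rule cont_loc_int_const)
  have key: "(?one \<star> f) s = c * (?one \<star> h) s + (?one \<star> (h \<star> g)) s" if "s > 0" for s
  proof -
    have "(?one \<star> f) s = (h \<star> k2 \<star> f) s"
      by (rule conv_cong) (auto simp: one h_def)
    also have "\<dots> = (h \<star> F) s"
      by (simp add: conv_assoc[OF hK K(3) fK] F_def GFI_def)
    also have "\<dots> = (h \<star> (\<lambda>x. c + (?one \<star> g) x)) s"
      by (rule conv_cong) (auto simp: F_def c_def g_def GFI_eq_init_plus_integral[OF f])
    also have "\<dots> = (h \<star> (\<lambda>x. c)) s + (h \<star> (?one \<star> g)) s"
      by (intro conv_add_right hK cont_loc_int_const conv_in_cont_loc_int gK)
    also have "h \<star> (?one \<star> g) = ?one \<star> (h \<star> g)"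
      using conv_assoc[OF hK oneK gK] conv_assoc[OF oneK hK gK] conv_commute[of h ?one] by simp
    also have "(h \<star> (\<lambda>x. c)) s = c * (h \<star> ?one) s"
      by (simp add: laplace_conv_def mult.commute)
    also have "h \<star> ?one = ?one \<star> h" by (rule conv_commute)
    finally show ?thesis .
  qed
  have "f t - c * h t - (h \<star> g) t = 0"
  proof (rule eq_0_if_integrals_eq_0[OF _ _ t])
    show "(\<lambda>x. f x - c * h x - (h \<star> g) x) \<in> cont_loc_int"
      by (intro cont_loc_int_diff cont_loc_int_cmult fK hK hgK)
    fix s :: real assume "s > 0"
    from key[OF this]
    show "(LBINT x:{0<..<s}. f x - c * h x - (h \<star> g) x) = 0"
      using cont_loc_int_integrable[OF fK, of s] cont_loc_int_integrable[OF hK, of s]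
        cont_loc_int_integrable[OF hgK, of s]
      by (simp add: conv_one set_integral_diff)
  qed
  moreover have "GFI \<kappa> (GFD1 k1 k2 f) t = (h \<star> g) t"
    by (simp add: GFD1_def GFI_def h_def g_def F_def conv_assoc[OF K(1,2) gK[unfolded g_def F_def GFI_def]])
  moreover have "k1 \<star> \<kappa> = h" unfolding h_def by (rule conv_commute)
  ultimately show "GFI \<kappa> (GFD1 k1 k2 f) t = f t - GFI_init k2 f * (k1 \<star> \<kappa>) t"
    by (simp add: c_def)
qed

end
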